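(* Let $n$ and $d$ be integers. If $n\ge d>3$, then $$P(n-1,d-3)\ \ge\ P(n,d).$$ If $n\ge d>2$, then $$P(n-1,d-2)\ \ge\ \frac{2}{n}\,P(n,d).$$
   Context: $S_n$ is the group of permutations of $Z_n=\{0,1,\ldots,n-1\}$. The Hamming distance $d(\mathbf{x},\mathbf{y})$ of $\mathbf{x},\mathbf{y}\in S_n$ is the number of $i\in Z_n$ with $\mathbf{x}(i)\neq\mathbf{y}(i)$. An $(n,d)$ permutation array (PA) is a subset $C\subseteq S_n$ in which any two distinct elements have distance at least $d$; $P(n,d)$ is the maximum size of an $(n,d)$ PA. *)

theory Defs
  imports Complex_Main "HOL-Combinatorics.Permutations"
begin

text \<open>Elements of \<open>S\<^sub>n\<close> are represented as functions on all naturals that permute \<open>{0..<n}\<close>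
  and are the identity outside of it.\<close>

definition Sym :: "nat \<Rightarrow> (nat \<Rightarrow> nat) set" where
  "Sym n = {x. x permutes {0..<n}}"

definition hamming_dist :: "nat \<Rightarrow> (nat \<Rightarrow> nat) \<Rightarrow> (nat \<Rightarrow> nat) \<Rightarrow> nat" where
  "hamming_dist n x y = card {i \<in> {0..<n}. x i \<noteq> y i}"

definition permutation_array :: "nat \<Rightarrow> nat \<Rightarrow> (nat \<Rightarrow> nat) set \<Rightarrow> bool" where
  "permutation_array n d C \<longleftrightarrow>
     C \<subseteq> Sym n \<and> (\<forall>x\<in>C. \<forall>y\<in>C. x \<noteq> y \<longrightarrow> d \<le> hamming_dist n x y)"

text \<open>The maximum is over a finite nonempty set, since \<open>Sym n\<close> is finite and the empty set
  is an \<open>(n,d)\<close> permutation array.\<close>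

definition P :: "nat \<Rightarrow> nat \<Rightarrow> nat" where
  "P n d = Max (card ` {C. permutation_array n d C})"

lemma finite_Sym: "finite (Sym n)"
  unfolding Sym_def by (rule finite_permutations) simp

lemma finite_permutation_arrays: "finite {C. permutation_array n d C}"
  by (rule finite_subset[of _ "Pow (Sym n)"])
    (auto simp: permutation_array_def finite_Sym)

lemma permutation_array_empty: "permutation_array n d {}"
  by (simp add: permutation_array_def)

end

theory Submission
  imports Defs
begin

text \<open>Contraction: delete the last position \<open>m\<close> of a permutation \<open>x\<close> of \<open>{0..m}\<close> and the symbol
  \<open>a\<close>, writing the orphaned symbol \<open>x m\<close> where \<open>a\<close> stood. Two contracted permutations can only
  lose disagreements at position \<open>m\<close> and at the two places of the symbol \<open>a\<close>, so at most three.
  The loss is at most two if only permutations with \<open>x m \<in> {a, b}\<close> are contracted: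
  when \<open>x m = y m\<close> the same relabelling is applied to both and nothing is lost, and when \<open>x m = a\<close>
  one of the places of \<open>a\<close> is \<open>m\<close> itself. Averaging over the cyclically adjacent pairs of symbols
  yields \<open>a, b\<close> for which at least a fraction \<open>2 / n\<close> of the array survives.\<close>

text \<open>The outer transposition renames the remaining symbols \<open>{0..m} - {a}\<close> to \<open>{0..<m}\<close>.\<close>

definition contract :: "nat \<Rightarrow> nat \<Rightarrow> (nat \<Rightarrow> nat) \<Rightarrow> nat \<Rightarrow> nat" where
  "contract m a x = transpose a m \<circ> transpose a (x m) \<circ> x"

lemma contract_in_Sym:
  assumes "x \<in> Sym (Suc m)" "a \<le> m"
  shows "contract m a x \<in> Sym m"
proof -
  have x: "x permutes {0..<Suc m}"
    using assms by (simp add: Sym_def)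
  then have "x m < Suc m"
    using permutes_in_image[OF x, of m] by simp
  then have "contract m a x permutes {0..<Suc m}"
    unfolding contract_def using x assms(2)
    by (intro permutes_compose permutes_swap_id) auto
  then have "contract m a x permutes {0..<m}"
    by (rule permutes_superset) (auto simp: contract_def less_Suc_eq)
  then show ?thesis
    by (simp add: Sym_def)
qed

lemma contract_eq_iff:
  assumes "x m = y m"
  shows "contract m a x i = contract m a y i \<longleftrightarrow> x i = y i"
  using assms by (simp add: contract_def inj_eq[OF inj_transpose])

text \<open>By injectivity \<open>x i\<close> differs from \<open>x m\<close>, and likewise for
  \<open>y\<close>, so the inner transpositions leave both values alone; the outer one is a
  bijection common to both.\<close>

lemma contract_neq:
  assumes "x \<in> Sym (Suc m)" "y \<in> Sym (Suc m)"
    and "x i \<noteq> y i" "i \<noteq> m" "x i \<noteq> a" "y i \<noteq> a"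
  shows "contract m a x i \<noteq> contract m a y i"
proof -
  have "x i \<noteq> x m" "y i \<noteq> y m"
    using assms permutes_inj[of _ "{0..<Suc m}"] by (auto simp: Sym_def dest: injD)
  then have "transpose a (x m) (x i) = x i" "transpose a (y m) (y i) = y i"
    using assms by (auto simp: transpose_def)
  then show ?thesis
    using assms(3) by (simp add: contract_def inj_eq[OF inj_transpose])
qed

text \<open>The cardinality of the exceptional set stays unevaluated: it is at most 3 in general and
  drops to 2 when two of its members coincide.\<close>

lemma hamming_dist_contract:
  assumes "x \<in> Sym (Suc m)" "y \<in> Sym (Suc m)"
  shows "hamming_dist (Suc m) x y \<le>
    hamming_dist m (contract m a x) (contract m a y) + card {m, inv x a, inv y a}"
proof -
  have inv: "inv x (x i) = i" "inv y (y i) = i" for i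
    using assms by (auto simp: Sym_def intro: permutes_inverses)
  have "{i \<in> {0..<Suc m}. x i \<noteq> y i} \<subseteq>
    {i \<in> {0..<m}. contract m a x i \<noteq> contract m a y i} \<union> {m, inv x a, inv y a}"
    using contract_neq[OF assms, of _ a] inv less_antisym by fastforce
  then have "hamming_dist (Suc m) x y \<le>
    card ({i \<in> {0..<m}. contract m a x i \<noteq> contract m a y i} \<union> {m, inv x a, inv y a})"
    unfolding hamming_dist_def by (rule card_mono[rotated]) simp
  then show ?thesis
    unfolding hamming_dist_def using card_Un_le order_trans by blast
qed

lemma hamming_dist_contract_le_3:
  assumes "x \<in> Sym (Suc m)" "y \<in> Sym (Suc m)"
  shows "hamming_dist (Suc m) x y \<le> hamming_dist m (contract m a x) (contract m a y) + 3"
proof -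
  have "card {m, inv x a, inv y a} \<le> 3"
    by (simp add: card_insert_if)
  then show ?thesis
    using hamming_dist_contract[OF assms, of a] by linarith
qed

lemma hamming_dist_contract_le_2:
  assumes "x \<in> Sym (Suc m)" "y \<in> Sym (Suc m)" and "x m = y m \<or> x m = a \<or> y m = a"
  shows "hamming_dist (Suc m) x y \<le> hamming_dist m (contract m a x) (contract m a y) + 2"
proof (cases "x m = y m")
  case True
  then have "{i \<in> {0..<Suc m}. x i \<noteq> y i} =
      {i \<in> {0..<m}. contract m a x i \<noteq> contract m a y i}"
    using contract_eq_iff[of x m y] by (auto simp: less_Suc_eq)
  then show ?thesis
    by (simp add: hamming_dist_def)
next
  case False
  have "inv x (x m) = m" "inv y (y m) = m"
    using assms by (auto simp: Sym_def intro: permutes_inverses)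
  then have "inv x a = m \<or> inv y a = m"
    using assms(3) False by auto
  then have "card {m, inv x a, inv y a} \<le> 2"
    by (auto simp: card_insert_if)
  then show ?thesis
    using hamming_dist_contract[OF assms(1,2), of a] by linarith
qed

lemma card_le_P: "permutation_array n d C \<Longrightarrow> card C \<le> P n d"
  unfolding P_def using finite_permutation_arrays by (intro Max_ge) auto

lemma permutation_array_P:
  obtains C where "permutation_array n d C" "card C = P n d"
proof -
  have "P n d \<in> card ` {C. permutation_array n d C}"
    unfolding P_def using finite_permutation_arrays
    by (intro Max_in) (auto intro: permutation_array_empty)
  then show thesis
    using that by auto
qed

lemma permutation_array_subset:
  "permutation_array n d C \<Longrightarrow> D \<subseteq> C \<Longrightarrow> permutation_array n d D"
  by (auto simp: permutation_array_def)

text \<open>Since the loss \<open>k\<close> is below \<open>d\<close>, distinct members of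
  \<open>C\<close> stay at positive distance; hence contraction is injective on \<open>C\<close> and
  its image is an array of the same size.\<close>

lemma card_le_P_contract:
  assumes C: "permutation_array (Suc m) d C" and "a \<le> m" "k < d"
    and loss: "\<And>x y. x \<in> C \<Longrightarrow> y \<in> C \<Longrightarrow>
      hamming_dist (Suc m) x y \<le> hamming_dist m (contract m a x) (contract m a y) + k"
  shows "card C \<le> P m (d - k)"
proof -
  have dist: "d - k \<le> hamming_dist m (contract m a x) (contract m a y)"
    if "x \<in> C" "y \<in> C" "x \<noteq> y" for x y
  proof -
    have "d \<le> hamming_dist (Suc m) x y"
      using C that by (simp add: permutation_array_def)
    then show ?thesis
      using loss[OF that(1,2)] by linarith
  qed
  have "inj_on (contract m a) C"
  proof (rule inj_onI, rule ccontr)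
    fix x y
    assume "x \<in> C" "y \<in> C" "contract m a x = contract m a y" "x \<noteq> y"
    then show False
      using dist[of x y] \<open>k < d\<close> by (simp add: hamming_dist_def)
  qed
  then have "card C = card (contract m a ` C)"
    by (simp add: card_image)
  also have "permutation_array m (d - k) (contract m a ` C)"
    using C \<open>a \<le> m\<close> dist contract_in_Sym by (fastforce simp: permutation_array_def)
  then have "card (contract m a ` C) \<le> P m (d - k)"
    by (rule card_le_P)
  finally show ?thesis .
qed

lemma sum_cyclic_shift:
  fixes f :: "nat \<Rightarrow> nat"
  shows "(\<Sum>s\<le>m. f (if s = m then 0 else Suc s)) = sum f {..m}"
proof -
  have "(\<Sum>s\<le>m. f (if s = m then 0 else Suc s)) = (\<Sum>s<m. f (Suc s)) + f 0"
    by (simp flip: lessThan_Suc_atMost)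
  then show ?thesis
    by (simp add: sum.lessThan_Suc_shift flip: lessThan_Suc_atMost del: sum.lessThan_Suc)
qed

text \<open>Every symbol lies in two of the \<open>Suc m\<close> cyclically adjacent pairs, so the
  fiber sizes summed over all pairs give \<open>2 * card C\<close>, and some pair reaches the
  average.\<close>

lemma exists_two_large_fibers:
  assumes C: "C \<subseteq> Sym (Suc m)" and "0 < m"
  obtains a b where "a \<le> m" "b \<le> m"
    "2 * card C \<le> Suc m * card {x \<in> C. x m = a \<or> x m = b}"
proof -
  define f where "f s = card {x \<in> C. x m = s}" for s
  define g where "g s = (if s = m then 0 else Suc s)" for s
  have fin: "finite C"
    using C finite_Sym finite_subset by blast
  have "x m \<in> {..m}" if "x \<in> C" for x
    using that C permutes_in_image[of x "{0..<Suc m}" m] by (force simp: Sym_def)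
  then have "C = (\<Union>s\<le>m. {x \<in> C. x m = s})"
    by auto
  then have "card C = card (\<Union>s\<le>m. {x \<in> C. x m = s})"
    by simp
  also have "\<dots> = sum f {..m}"
    unfolding f_def using fin by (intro card_UN_disjoint) auto
  finally have card_C: "card C = sum f {..m}" .
  have "\<exists>s\<le>m. 2 * card C \<le> Suc m * (f s + f (g s))"
  proof (rule ccontr)
    assume "\<not> ?thesis"
    then have "(\<Sum>s\<le>m. Suc m * (f s + f (g s))) < (\<Sum>s\<le>m. 2 * card C)"
      by (intro sum_strict_mono) auto
    moreover have "(\<Sum>s\<le>m. Suc m * (f s + f (g s))) = Suc m * (2 * card C)"
      using sum_cyclic_shift[of f m]
      by (simp add: card_C g_def sum.distrib flip: sum_distrib_left del: mult_Suc)
    ultimately show False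
      by simp
  qed
  then obtain s where s: "s \<le> m" "2 * card C \<le> Suc m * (f s + f (g s))"
    by blast
  \<comment> \<open>For \<open>m = 0\<close> the cyclic successor of 0 would be 0 itself, and its
    fiber would be counted twice.\<close>
  have "s \<noteq> g s"
    using \<open>0 < m\<close> by (auto simp: g_def)
  then have "f s + f (g s) = card ({x \<in> C. x m = s} \<union> {x \<in> C. x m = g s})"
    unfolding f_def using fin by (intro card_Un_disjoint[symmetric]) auto
  also have "{x \<in> C. x m = s} \<union> {x \<in> C. x m = g s} = {x \<in> C. x m = s \<or> x m = g s}"
    by auto
  finally show thesis
    using s that[of s "g s"] by (simp add: g_def)
qed

theorem theorem7:
  fixes n d :: nat
  shows "(n \<ge> d \<and> d > 3 \<longrightarrow> P (n - 1) (d - 3) \<ge> P n d) \<and>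
         (n \<ge> d \<and> d > 2 \<longrightarrow> real (P (n - 1) (d - 2)) \<ge> 2 / real n * real (P n d))"
proof (intro conjI impI; elim conjE)
  assume "n \<ge> d" "d > 3"
  then obtain m where n: "n = Suc m"
    by (cases n) auto
  obtain C where C: "permutation_array (Suc m) d C" "card C = P (Suc m) d"
    by (rule permutation_array_P)
  then have "C \<subseteq> Sym (Suc m)"
    by (simp add: permutation_array_def)
  \<comment> \<open>A loss of at most three holds for every symbol; the choice \<open>a = m\<close>
    makes the outer transposition trivial.\<close>
  then have "card C \<le> P m (d - 3)"
    using \<open>d > 3\<close>
    by (intro card_le_P_contract[where a = m, OF C(1)] hamming_dist_contract_le_3) auto
  then show "P (n - 1) (d - 3) \<ge> P n d"
    using C n by simp
next
  assume "n \<ge> d" "d > 2"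
  then obtain m where n: "n = Suc m" "0 < m"
    by (cases n) auto
  obtain C where C: "permutation_array (Suc m) d C" "card C = P (Suc m) d"
    by (rule permutation_array_P)
  then have sub: "C \<subseteq> Sym (Suc m)"
    by (simp add: permutation_array_def)
  obtain a b where ab: "a \<le> m" "2 * card C \<le> Suc m * card {x \<in> C. x m = a \<or> x m = b}"
    using exists_two_large_fibers[OF sub \<open>0 < m\<close>] by blast
  \<comment> \<open>Two members of this subarray either agree at \<open>m\<close> or one of them
    takes the value \<open>a\<close> there, so the loss is at most two.\<close>
  have "card {x \<in> C. x m = a \<or> x m = b} \<le> P m (d - 2)"
    using \<open>d > 2\<close> \<open>a \<le> m\<close> sub
    by (intro card_le_P_contract[where a = a] permutation_array_subset[OF C(1)]
        hamming_dist_contract_le_2) auto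
  then have "2 * card C \<le> Suc m * P m (d - 2)"
    using ab(2) mult_le_mono2 order_trans by blast
  then have "real (2 * card C) \<le> real (Suc m * P m (d - 2))"
    by (rule of_nat_mono)
  then show "real (P (n - 1) (d - 2)) \<ge> 2 / real n * real (P n d)"
    using C n by (simp add: field_simps)
qed

end
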